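(* For each integer $n\ge 2$ write $N=n-1$, and let $p_n$ and $\varphi$ be the probability densities on $\mathbb{R}$ defined in the context. Define $$Q(y):=\frac{3-y^4}{4}\,\varphi(y),\qquad y\in\mathbb{R}.$$ Then, as $n\to\infty$, $$N(p_n-\varphi)\longrightarrow Q\qquad\text{in }L^1(\mathbb{R}).$$
   Context: $\varphi(y)=(2\pi)^{-1/2}e^{-y^2/2}$ is the standard Gaussian density on $\mathbb{R}$. For $n\ge2$ and $N=n-1$, let $$h_N(y)=\begin{cases}\left(1-\frac{y^2}{N}\right)^{N/2}, & |y|\le\sqrt N,\\ 0,& |y|>\sqrt N,\end{cases}\qquad D_N=\int_{\mathbb{R}}h_N(y)\,dy,\qquad p_n(y)=\frac{h_N(y)}{D_N}.$$ (This is the density of $\theta/\tau_n$ where $\theta$ has density proportional to $(1-4\theta^2/\pi^2)^{N/2}$ on $[-\pi/2,\pi/2]$ and $\tau_n=\pi/(2\sqrt N)$; up to rescaling it is the one-dimensional marginal of the uniform distribution on a Euclidean ball in $\mathbb{R}^n$.) *)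

theory Defs
  imports "HOL-Probability.Probability"
begin

text \<open>The standard Gaussian density is the library's \<^const>\<open>std_normal_density\<close>.\<close>

definition h :: "nat \<Rightarrow> real \<Rightarrow> real" where
  "h N y = (if \<bar>y\<bar> \<le> sqrt (real N) then (1 - y\<^sup>2 / real N) powr (real N / 2) else 0)"

definition D :: "nat \<Rightarrow> real" where
  "D N = (LINT y|lborel. h N y)"

text \<open>Only meaningful for \<open>n \<ge> 2\<close>, where the truncated difference \<open>n - 1\<close> is the honest one.\<close>

definition p :: "nat \<Rightarrow> real \<Rightarrow> real" where
  "p n y = h (n - 1) y / D (n - 1)"

definition Q :: "real \<Rightarrow> real" where
  "Q y = (3 - y ^ 4) / 4 * std_normal_density y"

text \<open>
  Convergence in \<open>L\<^sup>1(M)\<close> of a sequence indexed by the integers \<open>n \<ge> n\<^sub>0\<close>. Membership in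
  \<open>L\<^sup>1(M)\<close> is required explicitly because the Bochner integral of a non-integrable function is
  \<open>0\<close> by convention.
\<close>

definition tendsto_L1 ::
    "'a measure \<Rightarrow> nat \<Rightarrow> (nat \<Rightarrow> 'a \<Rightarrow> real) \<Rightarrow> ('a \<Rightarrow> real) \<Rightarrow> bool" where
  "tendsto_L1 M n0 f g \<longleftrightarrow>
     (\<forall>n\<ge>n0. integrable M (f n)) \<and> integrable M g \<and>
     (\<lambda>n. LINT x|M. \<bar>f n x - g x\<bar>) \<longlonglongrightarrow> 0"

end

theory Submission
  imports Defs "HOL-Real_Asymp.Real_Asymp"
begin

text \<open>
  Compare \<open>h N\<close> with the unnormalised Gaussian \<open>g y = exp (- y\<^sup>2 / 2)\<close>. Expanding \<open>ln (1 - u)\<close> at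
  \<open>u = y\<^sup>2 / N\<close> gives \<open>N (h N y - g y) \<longlonglongrightarrow> - y ^ 4 / 4 * g y\<close> pointwise, and
  \<open>0 \<le> N (g y - h N y) \<le> (y ^ 4 + 2 * y\<^sup>2) * g y\<close> holds uniformly in \<open>N\<close>. By dominated convergence
  and the fourth Gaussian moment, \<open>N (D N - sqrt (2 * pi)) \<longlonglongrightarrow> - 3 / 4 * sqrt (2 * pi)\<close>. Hence
  \<open>N (h N / D N - g / sqrt (2 * pi))\<close> converges pointwise to \<open>Q\<close> with an integrable majorant
  independent of \<open>N\<close>, and dominated convergence applies once more.
\<close>

section \<open>Moments of the unnormalised Gaussian\<close>

lemma exp_eq_std_normal_density:
  "exp (- y\<^sup>2 / 2) = sqrt (2 * pi) * std_normal_density y"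
  by (simp add: std_normal_density_def)

lemma integrable_exp_power:
  "integrable lborel (\<lambda>y::real. y ^ k * exp (- y\<^sup>2 / 2))"
proof -
  have "integrable lborel (\<lambda>y::real. sqrt (2 * pi) * (std_normal_density y * y ^ k))"
    by (intro integrable_mult_right integrable_std_normal_moment)
  then show ?thesis
    unfolding exp_eq_std_normal_density by (simp add: mult_ac)
qed

lemma integrable_exp_half_square: "integrable lborel (\<lambda>y::real. exp (- y\<^sup>2 / 2))"
  using integrable_exp_power[of 0] by simp

lemma integral_exp_half_square: "(LINT y|lborel. exp (- y\<^sup>2 / 2)) = sqrt (2 * pi)"
proof -
  have "(LINT y|lborel. std_normal_density y) = 1"
    using integral_std_normal_moment_even[of 0] by simp
  then show ?thesis
    unfolding exp_eq_std_normal_density by simp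
qed

lemma integral_exp_half_square_power4:
  "(LINT y|lborel. y ^ 4 * exp (- y\<^sup>2 / 2)) = 3 * sqrt (2 * pi)"
proof -
  have "(LINT y|lborel. std_normal_density y * y ^ 4) = 3"
    using integral_std_normal_moment_even[of 2] by (simp add: fact_numeral)
  then have "(LINT y|lborel. sqrt (2 * pi) * (std_normal_density y * y ^ 4)) = 3 * sqrt (2 * pi)"
    by simp
  then show ?thesis
    unfolding exp_eq_std_normal_density by (simp add: mult_ac)
qed

section \<open>Bounds for \<open>h\<close> against the Gaussian\<close>

lemma measurable_h [measurable]: "h N \<in> borel_measurable borel"
  unfolding h_def by measurable

lemma h_nonneg: "0 \<le> h N y"
  by (simp add: h_def)

lemma abs_le_sqrt_iff: "\<bar>y\<bar> \<le> sqrt x \<longleftrightarrow> y\<^sup>2 \<le> x"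
  by (metis real_sqrt_abs real_sqrt_le_iff)

lemma h_eq_exp:
  assumes "y\<^sup>2 < real N"
  shows "h N y = exp (real N / 2 * ln (1 - y\<^sup>2 / real N))"
proof -
  have "y\<^sup>2 / real N < 1"
    using assms by (simp add: divide_less_eq)
  then show ?thesis
    using assms by (simp add: h_def abs_le_sqrt_iff powr_def)
qed

text \<open>Inside the support this is \<open>ln (1 - u) \<le> - u\<close> at
  \<open>u = y\<^sup>2 / N\<close>, multiplied by \<open>N / 2\<close> and exponentiated.\<close>

lemma h_le_exp: "h N y \<le> exp (- y\<^sup>2 / 2)"
proof -
  consider "y\<^sup>2 < real N" | "y\<^sup>2 = real N" | "y\<^sup>2 > real N" by linarith
  then show ?thesis
  proof cases
    case 1
    then have N: "0 < real N" and u: "y\<^sup>2 / real N < 1"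
      using zero_le_power2[of y] by (linarith, simp add: divide_less_eq)
    have "ln (1 - y\<^sup>2 / real N) \<le> - (y\<^sup>2 / real N)"
      using ln_le_minus_one[of "1 - y\<^sup>2 / real N"] u by simp
    then have "real N / 2 * ln (1 - y\<^sup>2 / real N) \<le> real N / 2 * - (y\<^sup>2 / real N)"
      by (intro mult_left_mono) auto
    then show ?thesis
      using N 1 by (simp add: h_eq_exp)
  next
    \<comment> \<open>For \<open>N > 0\<close> the base vanishes and \<open>0 powr x = 0\<close>.
      For \<open>N = 0\<close> also \<open>y = 0\<close>, and since \<open>0 / 0 = 0\<close> both
      sides equal 1.\<close>
    case 2
    then show ?thesis
      by (cases "N = 0") (auto simp: h_def)
  next
    case 3
    then show ?thesis
      by (simp add: h_def abs_le_sqrt_iff)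
  qed
qed

lemma integrable_h: "integrable lborel (h N)"
  by (rule Bochner_Integration.integrable_bound[OF integrable_exp_half_square])
    (use h_nonneg h_le_exp in auto)

text \<open>Each term of the majorant serves one regime: for \<open>N \<le> 2 * y\<^sup>2\<close>
  the factor \<open>N\<close> is itself absorbed by \<open>2 * y\<^sup>2\<close>; otherwise
  \<open>y\<^sup>2 / N\<close> is at most 1/2 and a second-order bound on the logarithm yields
  \<open>y ^ 4\<close>.\<close>

lemma abs_scaled_h_minus_exp_le:
  "\<bar>real N * (h N y - exp (- y\<^sup>2 / 2))\<bar> \<le> (y ^ 4 + 2 * y\<^sup>2) * exp (- y\<^sup>2 / 2)"
proof -
  define e where "e = exp (- y\<^sup>2 / 2)"
  have e: "0 < e" "h N y \<le> e"
    unfolding e_def by (rule exp_gt_zero, rule h_le_exp)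
  have "real N * (e - h N y) \<le> (y ^ 4 + 2 * y\<^sup>2) * e"
  proof (cases "real N \<le> 2 * y\<^sup>2")
    case True
    have "real N * (e - h N y) \<le> (2 * y\<^sup>2) * e"
      using True e h_nonneg[of N y] by (intro mult_mono) auto
    also have "\<dots> \<le> (y ^ 4 + 2 * y\<^sup>2) * e"
      using e by (intro mult_right_mono) auto
    finally show ?thesis .
  next
    case False
    then have N: "0 < real N" and lt: "y\<^sup>2 < real N"
      using zero_le_power2[of y] by linarith+
    define u where "u = y\<^sup>2 / real N"
    have u: "0 \<le> u" "u \<le> 1 / 2"
      using False N by (auto simp: u_def field_simps)
    have y: "y\<^sup>2 = real N * u" "y ^ 4 = (real N * u)\<^sup>2"
      using N by (simp_all add: u_def flip: power_mult)
    \<comment> \<open>\<open>t\<close> is the logarithm of the ratio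
      \<open>h N y / e\<close>.\<close>
    define t where "t = real N / 2 * (ln (1 - u) + u)"
    have "h N y = e * exp t"
      using lt by (simp add: h_eq_exp e_def t_def y flip: u_def exp_add) (simp add: algebra_simps)
    then have "real N * (e - h N y) = real N * e * (1 - exp t)"
      by (simp add: algebra_simps)
    also have "\<dots> \<le> real N * e * - t"
    proof (intro mult_left_mono)
      show "1 - exp t \<le> - t"
        using exp_ge_add_one_self[of t] by linarith
    qed (use e in auto)
    also have "\<dots> \<le> real N * e * (real N * u\<^sup>2)"
    proof (intro mult_left_mono)
      \<comment> \<open>Uses \<open>ln (1 - u) \<ge> - u - 2 * u\<^sup>2\<close>, valid for u in
        [0, 1/2]; this is why the cases split at \<open>2 * y\<^sup>2\<close>.\<close>
      have "real N / 2 * (- ln (1 - u) - u) \<le> real N / 2 * (2 * u\<^sup>2)"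
        using ln_one_minus_pos_lower_bound[of u] u by (intro mult_left_mono) auto
      then show "- t \<le> real N * u\<^sup>2"
        by (simp add: t_def algebra_simps add_divide_distrib)
    qed (use e in auto)
    also have "\<dots> = y ^ 4 * e"
      by (simp add: y power2_eq_square)
    also have "\<dots> \<le> (y ^ 4 + 2 * y\<^sup>2) * e"
      using e by (intro mult_right_mono) auto
    finally show ?thesis .
  qed
  moreover have "\<bar>real N * (h N y - e)\<bar> = real N * (e - h N y)"
    using e by (simp add: abs_mult)
  ultimately show ?thesis
    by (simp add: e_def)
qed

section \<open>Pointwise first-order asymptotics\<close>

lemma tendsto_scaled_powr_minus_exp:
  fixes a :: real
  assumes "0 \<le> a"
  shows "(\<lambda>n. real n * ((1 - a / real n) powr (real n / 2) - exp (- a / 2)))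
           \<longlonglongrightarrow> - (a\<^sup>2 / 4) * exp (- a / 2)"
proof (cases "a = 0")
  case False
  then have "0 < a" using assms by simp
  \<comment> \<open>The exponent \<open>n / 2 * ln (1 - a / n)\<close> expands as
    \<open>- a / 2 - a\<^sup>2 / (4 * n)\<close> up to order \<open>1 / n\<^sup>2\<close>.\<close>
  then show ?thesis unfolding power2_eq_square by (real_asymp simp: mult_ac)
qed (auto intro!: tendsto_eventually eventually_mono[OF eventually_gt_at_top[of 0]])

lemma tendsto_scaled_h_minus_exp:
  "(\<lambda>N. real N * (h N y - exp (- y\<^sup>2 / 2))) \<longlonglongrightarrow> - (y ^ 4 / 4) * exp (- y\<^sup>2 / 2)"
proof -
  \<comment> \<open>For fixed \<open>y\<close> the truncation is inactive once
    \<open>N \<ge> y\<^sup>2\<close>.\<close>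
  have "\<forall>\<^sub>F N in sequentially. h N y = (1 - y\<^sup>2 / real N) powr (real N / 2)"
    using eventually_ge_at_top[of "nat \<lceil>y\<^sup>2\<rceil>"]
    by eventually_elim (simp add: h_def abs_le_sqrt_iff nat_ceiling_le_eq)
  then have ev: "\<forall>\<^sub>F N in sequentially.
      real N * ((1 - y\<^sup>2 / real N) powr (real N / 2) - exp (- y\<^sup>2 / 2))
      = real N * (h N y - exp (- y\<^sup>2 / 2))"
    by eventually_elim simp
  have "(y\<^sup>2)\<^sup>2 = y ^ 4" by simp
  with Lim_transform_eventually[OF tendsto_scaled_powr_minus_exp ev] show ?thesis
    by simp
qed

section \<open>The normalising constant\<close>

lemma integrable_dominating:
  "integrable lborel (\<lambda>y::real. (y ^ 4 + 2 * y\<^sup>2) * exp (- y\<^sup>2 / 2))"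
proof -
  have "integrable lborel
      (\<lambda>y::real. y ^ 4 * exp (- y\<^sup>2 / 2) + 2 * (y ^ 2 * exp (- y\<^sup>2 / 2)))"
    by (intro Bochner_Integration.integrable_add integrable_mult_right integrable_exp_power)
  then show ?thesis by (simp add: algebra_simps)
qed

lemma tendsto_scaled_D:
  "(\<lambda>N. real N * (D N - sqrt (2 * pi))) \<longlonglongrightarrow> - (3 / 4) * sqrt (2 * pi)"
proof -
  have "(\<lambda>N. LINT y|lborel. real N * (h N y - exp (- y\<^sup>2 / 2)))
      \<longlonglongrightarrow> (LINT y|lborel. - (y ^ 4 / 4) * exp (- y\<^sup>2 / 2))"
    by (rule integral_dominated_convergence[OF _ _ integrable_dominating])
      (use abs_scaled_h_minus_exp_le tendsto_scaled_h_minus_exp in auto)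
  moreover have "(LINT y|lborel. real N * (h N y - exp (- y\<^sup>2 / 2)))
      = real N * (D N - sqrt (2 * pi))" for N
    using Bochner_Integration.integral_diff[OF integrable_h integrable_exp_half_square, of N]
    unfolding integral_exp_half_square by (simp add: D_def)
  moreover have "(LINT y::real|lborel. - (y ^ 4 / 4) * exp (- y\<^sup>2 / 2))
      = (LINT y|lborel. - (1 / 4) * (y ^ 4 * exp (- y\<^sup>2 / 2)))"
    by simp
  ultimately show ?thesis
    by (simp only: integral_mult_right_zero integral_exp_half_square_power4) simp
qed

text \<open>The scaled error converges, so the error itself is of order
  \<open>1 / N\<close>.\<close>

lemma tendsto_D: "D \<longlonglongrightarrow> sqrt (2 * pi)"
proof -
  have "(\<lambda>N. real N * (D N - sqrt (2 * pi)) * inverse (real N)) \<longlonglongrightarrow> - (3 / 4) * sqrt (2 * pi) * 0"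
    by (intro tendsto_mult tendsto_scaled_D lim_inverse_n)
  then have "(\<lambda>N. D N - sqrt (2 * pi)) \<longlonglongrightarrow> 0"
    by (simp, elim Lim_transform_eventually)
      (auto intro: eventually_mono[OF eventually_gt_at_top[of 0]])
  then show ?thesis
    by (simp add: LIM_zero_iff)
qed

section \<open>Convergence of the densities in L1\<close>

lemma Q_eq: "Q y = (3 - y ^ 4) / 4 * exp (- y\<^sup>2 / 2) / sqrt (2 * pi)"
  by (simp add: Q_def std_normal_density_def)

lemma integrable_Q: "integrable lborel Q"
proof -
  have "integrable lborel (\<lambda>y. 3 / (4 * sqrt (2 * pi)) * exp (- y\<^sup>2 / 2)
      - 1 / (4 * sqrt (2 * pi)) * (y ^ 4 * exp (- y\<^sup>2 / 2)))"
    by (intro Bochner_Integration.integrable_diff integrable_mult_right integrable_exp_power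
        integrable_exp_half_square)
  then show ?thesis
    unfolding Q_eq[abs_def] by (simp add: field_simps)
qed

lemma tendsto_L1_scaled_density:
  "(\<lambda>N. LINT y|lborel. \<bar>real N * (h N y / D N - std_normal_density y) - Q y\<bar>) \<longlonglongrightarrow> 0"
proof -
  define G where "G = sqrt (2 * pi)"
  have G: "G > 0" by (simp add: G_def)
  define g where "g = (\<lambda>y::real. exp (- y\<^sup>2 / 2))"
  define w where "w = (\<lambda>y::real. (y ^ 4 + 2 * y\<^sup>2) * g y)"
  define c where "c N = 1 / D N" for N
  define b where "b N = real N * (1 / D N - 1 / G)" for N
  \<comment> \<open>Separates the error in shape, \<open>h N - g\<close>, from the error
    \<open>b N\<close> in the reciprocal normalising constant.\<close>
  have split: "real N * (h N y / D N - std_normal_density y)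
      = c N * (real N * (h N y - g y)) + b N * g y" for N y
    by (simp add: c_def b_def G_def g_def std_normal_density_def algebra_simps)
  have c: "c \<longlonglongrightarrow> 1 / G"
    unfolding c_def using G tendsto_D by (intro tendsto_intros) (auto simp: G_def)
  have scaled: "(\<lambda>N. real N * (D N - G)) \<longlonglongrightarrow> - (3 / 4) * G"
    unfolding G_def by (rule tendsto_scaled_D)
  \<comment> \<open>Rests on \<open>1 / D - 1 / G = - (D - G) / (D * G)\<close>. This needs
    \<open>D N\<close> nonzero, which holds only eventually: \<open>D 0 = 0\<close>, as
    \<open>h 0\<close> vanishes off the origin.\<close>
  have "(\<lambda>N. - (real N * (D N - G)) * c N / G) \<longlonglongrightarrow> - (- (3 / 4) * G) * (1 / G) / G"
    using G by (intro tendsto_divide tendsto_mult tendsto_minus tendsto_const scaled c) auto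
  moreover have "\<forall>\<^sub>F N in sequentially. - (real N * (D N - G)) * c N / G = b N"
  proof -
    have "\<forall>\<^sub>F N in sequentially. 0 < D N"
      using order_tendstoD(1)[OF tendsto_D] by simp
    then show ?thesis
      by eventually_elim (use G in \<open>simp add: b_def c_def field_simps\<close>)
  qed
  ultimately have b: "b \<longlonglongrightarrow> 3 / (4 * G)"
    using G by (auto dest: Lim_transform_eventually)
  \<comment> \<open>Convergent sequences are bounded, so \<open>K\<close> and \<open>L\<close> give
    a majorant independent of \<open>N\<close>.\<close>
  obtain K where K: "\<And>N. \<bar>c N\<bar> \<le> K"
    using convergent_imp_Bseq[OF convergentI[OF c]] by (auto simp: Bseq_def)
  obtain L where L: "\<And>N. \<bar>b N\<bar> \<le> L"
    using convergent_imp_Bseq[OF convergentI[OF b]] by (auto simp: Bseq_def)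
  have [measurable]: "Q \<in> borel_measurable borel" "g \<in> borel_measurable borel"
    using integrable_Q by (auto simp: g_def)
  have "(\<lambda>N. LINT y|lborel. \<bar>real N * (h N y / D N - std_normal_density y) - Q y\<bar>)
      \<longlonglongrightarrow> (LINT y::real|lborel. (0::real))"
  proof (rule integral_dominated_convergence[where w = "\<lambda>y. K * w y + L * g y + \<bar>Q y\<bar>"])
    show "integrable lborel (\<lambda>y. K * w y + L * g y + \<bar>Q y\<bar>)"
      unfolding w_def g_def
      by (intro Bochner_Integration.integrable_add integrable_mult_right integrable_abs
          integrable_dominating integrable_exp_half_square integrable_Q)
    show "AE y in lborel. (\<lambda>N. \<bar>real N * (h N y / D N - std_normal_density y) - Q y\<bar>) \<longlonglongrightarrow> 0"
    proof (rule AE_I2)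
      fix y
      have "(\<lambda>N. c N * (real N * (h N y - g y)) + b N * g y)
          \<longlonglongrightarrow> 1 / G * (- (y ^ 4 / 4) * g y) + 3 / (4 * G) * g y"
        unfolding g_def
        by (intro tendsto_add tendsto_mult tendsto_const tendsto_scaled_h_minus_exp b c)
      \<comment> \<open>The \<open>- y ^ 4\<close> in \<open>Q\<close> comes from the shape error,
        the 3 from the normalisation.\<close>
      also have "1 / G * (- (y ^ 4 / 4) * g y) + 3 / (4 * G) * g y = Q y"
        using G unfolding Q_eq g_def G_def[symmetric] by (simp add: field_simps)
      finally show "(\<lambda>N. \<bar>real N * (h N y / D N - std_normal_density y) - Q y\<bar>) \<longlonglongrightarrow> 0"
        unfolding split by (intro tendsto_rabs_zero LIM_zero)
    qed
    show "AE y in lborel. norm \<bar>real N * (h N y / D N - std_normal_density y) - Q y\<bar>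
        \<le> K * w y + L * g y + \<bar>Q y\<bar>" for N
    proof (rule AE_I2)
      fix y
      have "\<bar>c N * (real N * (h N y - g y))\<bar> \<le> K * w y"
        unfolding abs_mult[of "c N"] using K[of N] abs_scaled_h_minus_exp_le[of N y]
        by (intro mult_mono) (auto simp: w_def g_def)
      moreover have "\<bar>b N * g y\<bar> \<le> L * g y"
        using L[of N] by (simp add: abs_mult g_def)
      ultimately show "norm \<bar>real N * (h N y / D N - std_normal_density y) - Q y\<bar>
          \<le> K * w y + L * g y + \<bar>Q y\<bar>"
        unfolding split by simp
    qed
  qed measurable
  then show ?thesis by simp
qed

theorem theorem5p6:
  shows "tendsto_L1 lborel 2 (\<lambda>n y. real (n - 1) * (p n y - std_normal_density y)) Q"
  unfolding tendsto_L1_def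
proof (intro conjI allI impI)
  show "integrable lborel (\<lambda>y. real (n - 1) * (p n y - std_normal_density y))" for n
    unfolding p_def
    by (intro integrable_mult_right Bochner_Integration.integrable_diff integrable_divide
        integrable_h) simp
  show "integrable lborel Q"
    by (rule integrable_Q)
  show "(\<lambda>n. LINT y|lborel. \<bar>real (n - 1) * (p n y - std_normal_density y) - Q y\<bar>) \<longlonglongrightarrow> 0"
    unfolding p_def
    \<comment> \<open>Reindexes by \<open>N = n - 1\<close>, which tends to infinity with
      \<open>n\<close>.\<close>
    using filterlim_compose[OF tendsto_L1_scaled_density filterlim_minus_const_nat_at_top[of 1]] .
qed

end
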